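(* Let $V$ be a finite dimensional vector space. (1) Let $l,l'\in\mathcal{L}(V)$ be two distinct Lie polynomials over $V$. Then there exists a finite dimensional development $\Phi:V\to\mathrm{End}(W)$ such that $\Phi(l)\neq\Phi(l')$. (2) Let $g_1,g_2$ be the signatures of two weakly geometric rough paths over $V$. Suppose that $g_1\neq g_2$. Then there exists a finite dimensional development $\Phi:V\to\mathrm{End}(W)$ such that $\Phi(g_1)\neq\Phi(g_2)$.
   Context: $V$ is over $\mathbb{F}=\mathbb{R}$ or $\mathbb{C}$; being finite dimensional, it is given any norm, and the tensor powers $V^{\otimes n}$ carry the associated projective tensor norms $\|\xi\|=\inf\{\sum_{i}\|v_1^i\|\cdots\|v_n^i\|:\xi=\sum_{i} v_1^i\otimes\cdots\otimes v_n^i\}$ (finite sums). $T((V))=\prod_{n\geqslant0}V^{\otimes n}$, $T^{(n)}(V)=\oplus_{k=0}^nV^{\otimes k}$ (products truncated at degree $n$), $\exp(\xi)=\sum_{k\geqslant0}\xi^{\otimes k}/k!$. With $[\xi,\eta]=\xi\otimes\eta-\eta\otimes\xi$, set $\mathcal{L}_1(V)=V$, $\mathcal{L}_{n+1}(V)=[V,\mathcal{L}_n(V)]$ (linear span of brackets), $\mathcal{L}(V)=\oplus_{n\geqslant1}\mathcal{L}_n(V)$ (the free Lie algebra; its elements are the Lie polynomials), $\mathcal{L}^{(n)}(V)=\oplus_{k=1}^n\mathcal{L}_k(V)$ and $G^{(n)}(V)=\exp(\mathcal{L}^{(n)}(V))\subseteq T^{(n)}(V)$. A finite dimensional development $\Phi:V\to\mathrm{End}(W)$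 is a linear map from $V$ into the linear endomorphisms of a finite dimensional complex normed space $W$ (possibly factoring as $\Phi=\rho\circ F$ with $F:V\to\mathfrak{g}$ linear into a finite dimensional complex Lie algebra and $\rho:\mathfrak{g}\to\mathrm{End}(W)$ a representation); if $V$ is real, linearity is over $\mathbb{R}$. It induces linear maps $\Phi^{(n)}:V^{\otimes n}\to\mathrm{End}(W)$, $\Phi^{(n)}(v_1\otimes\cdots\otimes v_n)=\Phi(v_1)\cdots\Phi(v_n)$, and one sets $\Phi(\xi)=\xi_0\mathrm{Id}+\sum_{n\geqslant1}\Phi^{(n)}(\xi_n)$ for $\xi=(\xi_0,\xi_1,\dots)\in T((V))$ whenever the series converges in operator norm (it always does for Lie polynomials and for signatures). For $p\geqslant1$, a $p$-rough path on $[0,T]$ is a continuous map ${\bf X}=(1,X^1,\dots,X^{\lfloor p\rfloor}):\{0\leqslant s\leqslant t\leqslant T\}\to T^{(\lfloor p\rfloor)}(V)$ with ${\bf X}_{s,u}={\bf X}_{s,t}\otimes{\bf X}_{t,u}$ and finite total $p$-variation $\sum_{k=1}^{\lfloor p\rfloor}\sup_{\mathcal{P}}\big(\sum_{t_i\in\mathcal{P}}\|X^k_{t_{i-1},t_i}\|^{p/k}\big)^{k/p}<\infty$; it is weakly geometric if it takes values in $G^{(\lfloor p\rfloor)}(V)$. By Lyons' extension theorem ${\bf X}$ extends uniquely to a multiplicative functional $\mathbb{X}_{s,t}=(1,X^1_{s,t},X^2_{s,t},\dots)\in T((V))$ all of whose truncations have finite total $p$-variation (same formula with $k$ up to the truncation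 degree), and there are constants $\beta_p>0$, $\omega\geqslant0$ with $\|X^n_{0,T}\|\leqslant\omega^{n/p}/(\beta_p\,\Gamma(n/p+1))$ for all $n\geqslant1$. The signature of ${\bf X}$ is $\mathbb{X}_{0,T}$. *)

theory Defs
  imports Complex_Main "HOL-Library.Function_Algebras"
begin

section \<open>Ground field and norms\<close>

text \<open>
  The ground field is the reals or the complex numbers, together with its embedding into the complex
  numbers. Both are instances, and every instance is isomorphic to one of the two, since
  a real subalgebra of the complex numbers that contains 1 is the reals or everything.
\<close>

class real_or_complex = real_normed_field +
  fixes to_complex :: "'a \<Rightarrow> complex"
  assumes to_complex_add: "to_complex (x + y) = to_complex x + to_complex y"
    and to_complex_mult: "to_complex (x * y) = to_complex x * to_complex y"
    and to_complex_one: "to_complex 1 = 1"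
    and to_complex_scaleR: "to_complex (r *\<^sub>R x) = r *\<^sub>R to_complex x"
    and norm_to_complex: "norm (to_complex x) = norm x"

instantiation real :: real_or_complex
begin
definition to_complex_real :: "real \<Rightarrow> complex" where "to_complex_real x = complex_of_real x"
instance by standard (simp_all add: to_complex_real_def scaleR_conv_of_real)
end

instantiation complex :: real_or_complex
begin
definition to_complex_complex :: "complex \<Rightarrow> complex" where "to_complex_complex z = z"
instance by standard (simp_all add: to_complex_complex_def)
end

definition norm_on ::
  "('f::real_normed_field \<Rightarrow> 'a::ab_group_add \<Rightarrow> 'a) \<Rightarrow> 'a set \<Rightarrow> ('a \<Rightarrow> real) \<Rightarrow> bool" where
  "norm_on scale S N \<longleftrightarrow>
     (\<forall>x\<in>S. 0 \<le> N x \<and> (N x = 0 \<longleftrightarrow> x = 0)) \<and>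
     (\<forall>x\<in>S. \<forall>y\<in>S. N (x + y) \<le> N x + N y) \<and>
     (\<forall>c. \<forall>x\<in>S. N (scale c x) = norm c * N x)"

definition fscale :: "'f::field \<Rightarrow> ('a \<Rightarrow> 'f) \<Rightarrow> 'a \<Rightarrow> 'f" where
  "fscale c x = (\<lambda>i. c * x i)"

interpretation fscale: vector_space fscale
  by standard (simp_all add: fscale_def fun_eq_iff algebra_simps)

section \<open>Tensor series\<close>

text \<open>
  \<open>V\<close> is the type \<open>'v\<close> with scalar multiplication \<open>scale\<close>. For finite dimensional \<open>V\<close>, the \<open>n\<close>-th
  tensor power is realised inside the \<open>n\<close>-linear forms on the dual space: \<open>v\<^sub>1 \<otimes> \<dots> \<otimes> v\<^sub>n\<close> is the form
  \<open>(f\<^sub>1, \<dots>, f\<^sub>n) \<mapsto> f\<^sub>1 v\<^sub>1 \<dots> f\<^sub>n v\<^sub>n\<close>. A tensor series is one function on lists of linear functionals,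
  whose component of degree \<open>n\<close> is its restriction to lists of length \<open>n\<close> (zero elsewhere, in
  particular on lists containing a function that is not linear).
\<close>

type_synonym ('v, 'f) tensor = "('v \<Rightarrow> 'f) list \<Rightarrow> 'f"

definition tensor_of ::
  "('f::field \<Rightarrow> 'v::ab_group_add \<Rightarrow> 'v) \<Rightarrow> 'v list \<Rightarrow> ('v, 'f) tensor" where
  "tensor_of scale vs = (\<lambda>fs.
     if length fs = length vs \<and> (\<forall>f\<in>set fs. Vector_Spaces.linear scale (*) f)
     then prod_list (map2 (\<lambda>f v. f v) fs vs) else 0)"

definition tensor_power ::
  "('f::field \<Rightarrow> 'v::ab_group_add \<Rightarrow> 'v) \<Rightarrow> nat \<Rightarrow> ('v, 'f) tensor set" where
  "tensor_power scale n = fscale.span {tensor_of scale vs | vs. length vs = n}"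

definition grade :: "nat \<Rightarrow> ('v, 'f::field) tensor \<Rightarrow> ('v, 'f) tensor" where
  "grade n \<xi> = (\<lambda>fs. if length fs = n then \<xi> fs else 0)"

definition truncate :: "nat \<Rightarrow> ('v, 'f::field) tensor \<Rightarrow> ('v, 'f) tensor" where
  "truncate n \<xi> = (\<lambda>fs. if length fs \<le> n then \<xi> fs else 0)"

definition tensor_series ::
  "('f::field \<Rightarrow> 'v::ab_group_add \<Rightarrow> 'v) \<Rightarrow> ('v, 'f) tensor set" where
  "tensor_series scale = {\<xi>. \<forall>n. grade n \<xi> \<in> tensor_power scale n}"

text \<open>The space \<open>T\<^sup>(\<^sup>n\<^sup>)(V)\<close>; its product is \<open>truncate n (tmult \<xi> \<eta>)\<close>.\<close>

definition truncated_tensors ::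
  "('f::field \<Rightarrow> 'v::ab_group_add \<Rightarrow> 'v) \<Rightarrow> nat \<Rightarrow> ('v, 'f) tensor set" where
  "truncated_tensors scale n = {\<xi> \<in> tensor_series scale. truncate n \<xi> = \<xi>}"

definition tmult ::
  "('v, 'f::field) tensor \<Rightarrow> ('v, 'f) tensor \<Rightarrow> ('v, 'f) tensor" where
  "tmult \<xi> \<eta> = (\<lambda>fs. \<Sum>k\<le>length fs. \<xi> (take k fs) * \<eta> (drop k fs))"

lemma tmult_tensor_of:
  fixes scale :: "'f::field \<Rightarrow> 'v::ab_group_add \<Rightarrow> 'v"
  shows "tmult (tensor_of scale us) (tensor_of scale vs) = tensor_of scale (us @ vs)"
proof
  fix fs :: "('v \<Rightarrow> 'f) list"
  let ?t = "\<lambda>k. tensor_of scale us (take k fs) * tensor_of scale vs (drop k fs)"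
  have zero: "?t k = 0" if "k \<le> length fs" "k \<noteq> length us" for k
    using that by (auto simp: tensor_of_def)
  show "tmult (tensor_of scale us) (tensor_of scale vs) fs = tensor_of scale (us @ vs) fs"
  proof (cases "length us \<le> length fs")
    case True
    have "(\<Sum>k\<le>length fs. ?t k) = (\<Sum>k\<in>{length us}. ?t k)"
      by (rule sum.mono_neutral_right) (use True zero in auto)
    also have "\<dots> = tensor_of scale (us @ vs) fs"
    proof -
      obtain gs hs where "fs = gs @ hs" "length gs = length us"
        using True by (metis append_take_drop_id length_take min.absorb2)
      then show ?thesis
        by (auto simp: tensor_of_def)
    qed
    finally show ?thesis by (simp add: tmult_def)
  next
    case False
    then have "(\<Sum>k\<le>length fs. ?t k) = 0"
      by (intro sum.neutral) (use zero in auto)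
    then show ?thesis using False by (simp add: tmult_def tensor_of_def)
  qed
qed

text \<open>The value in degree 0 is \<open>\<xi> []\<close>, and \<open>tensor_of scale []\<close> is the unit.\<close>

primrec tpow ::
  "('f::field \<Rightarrow> 'v::ab_group_add \<Rightarrow> 'v) \<Rightarrow> ('v, 'f) tensor \<Rightarrow> nat \<Rightarrow> ('v, 'f) tensor" where
  "tpow scale \<xi> 0 = tensor_of scale []"
| "tpow scale \<xi> (Suc k) = tmult \<xi> (tpow scale \<xi> k)"

definition texp ::
  "('f::real_normed_field \<Rightarrow> 'v::ab_group_add \<Rightarrow> 'v) \<Rightarrow> ('v, 'f) tensor \<Rightarrow> ('v, 'f) tensor" where
  "texp scale \<xi> = (\<lambda>fs. \<Sum>k. tpow scale \<xi> k fs / fact k)"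

text \<open>The projective norm on the tensor power of degree \<open>n \<ge> 1\<close>.\<close>

definition proj_norm ::
  "('f::real_normed_field \<Rightarrow> 'v::ab_group_add \<Rightarrow> 'v) \<Rightarrow> ('v \<Rightarrow> real) \<Rightarrow> nat \<Rightarrow> ('v, 'f) tensor \<Rightarrow> real" where
  "proj_norm scale nrm n \<xi> =
     Inf {(\<Sum>vs\<leftarrow>R. prod_list (map nrm vs)) | R.
            (\<forall>vs\<in>set R. length vs = n) \<and> \<xi> = (\<Sum>vs\<leftarrow>R. tensor_of scale vs)}"

section \<open>Lie polynomials\<close>

definition lie_bracket ::
  "('v, 'f::field) tensor \<Rightarrow> ('v, 'f) tensor \<Rightarrow> ('v, 'f) tensor" where
  "lie_bracket \<xi> \<eta> = tmult \<xi> \<eta> - tmult \<eta> \<xi>"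

fun lie_layer ::
  "('f::field \<Rightarrow> 'v::ab_group_add \<Rightarrow> 'v) \<Rightarrow> nat \<Rightarrow> ('v, 'f) tensor set" where
  "lie_layer scale 0 = {0}"
| "lie_layer scale (Suc 0) = {tensor_of scale [v] | v. True}"
| "lie_layer scale (Suc (Suc n)) =
     fscale.span {lie_bracket (tensor_of scale [v]) \<eta> | v \<eta>. \<eta> \<in> lie_layer scale (Suc n)}"

definition lie_polynomials ::
  "('f::field \<Rightarrow> 'v::ab_group_add \<Rightarrow> 'v) \<Rightarrow> ('v, 'f) tensor set" where
  "lie_polynomials scale =
     {\<xi>. (\<forall>n. grade n \<xi> \<in> lie_layer scale n) \<and> finite {n. grade n \<xi> \<noteq> 0}}"

definition truncated_lie_polynomials ::
  "('f::field \<Rightarrow> 'v::ab_group_add \<Rightarrow> 'v) \<Rightarrow> nat \<Rightarrow> ('v, 'f) tensor set" where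
  "truncated_lie_polynomials scale n = {\<xi> \<in> lie_polynomials scale. truncate n \<xi> = \<xi>}"

definition grouplike ::
  "('f::real_normed_field \<Rightarrow> 'v::ab_group_add \<Rightarrow> 'v) \<Rightarrow> nat \<Rightarrow> ('v, 'f) tensor set" where
  "grouplike scale n = (\<lambda>\<xi>. truncate n (texp scale \<xi>)) ` truncated_lie_polynomials scale n"

section \<open>Rough paths and signatures\<close>

definition time_simplex :: "real \<Rightarrow> (real \<times> real) set" where
  "time_simplex T = {(s, t). 0 \<le> s \<and> s \<le> t \<and> t \<le> T}"

text \<open>
  Finite total \<open>p\<close>-variation up to degree \<open>n\<close>: a finite sum of powers of suprema is finite
  iff each of the suprema is.
\<close>

definition finite_p_variation ::
  "('f::real_normed_field \<Rightarrow> 'v::ab_group_add \<Rightarrow> 'v) \<Rightarrow> ('v \<Rightarrow> real) \<Rightarrow> real \<Rightarrow> real \<Rightarrow> nat \<Rightarrow>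
     (real \<Rightarrow> real \<Rightarrow> ('v, 'f) tensor) \<Rightarrow> bool" where
  "finite_p_variation scale nrm p T n X \<longleftrightarrow>
     (\<forall>k\<in>{1..n}. bdd_above
        {(\<Sum>i<m. proj_norm scale nrm k (grade k (X (\<tau> i) (\<tau> (Suc i)))) powr (p / real k)) | \<tau> m.
           \<tau> 0 = 0 \<and> \<tau> m = T \<and> (\<forall>i<m. \<tau> i < \<tau> (Suc i))})"

text \<open>
  Multiplicative functionals with values in \<open>T\<^sup>(\<^sup>n\<^sup>)(V)\<close>. As usual, continuity is part of the notion
  (without it the extension below would not be unique). Since \<open>T\<^sup>(\<^sup>n\<^sup>)(V)\<close> is a finite direct sum and
  the component of degree 0 is constant, continuity is that of the components of degree \<open>\<ge> 1\<close>.
\<close>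

definition multiplicative_functional ::
  "('f::real_normed_field \<Rightarrow> 'v::ab_group_add \<Rightarrow> 'v) \<Rightarrow> ('v \<Rightarrow> real) \<Rightarrow> real \<Rightarrow> real \<Rightarrow> nat \<Rightarrow>
     (real \<Rightarrow> real \<Rightarrow> ('v, 'f) tensor) \<Rightarrow> bool" where
  "multiplicative_functional scale nrm p T n X \<longleftrightarrow>
     (\<forall>(s, t)\<in>time_simplex T. X s t \<in> truncated_tensors scale n \<and> X s t [] = 1) \<and>
     (\<forall>s t u. 0 \<le> s \<and> s \<le> t \<and> t \<le> u \<and> u \<le> T \<longrightarrow> X s u = truncate n (tmult (X s t) (X t u))) \<and>
     (\<forall>k\<in>{1..n}. \<forall>(s, t)\<in>time_simplex T.
        ((\<lambda>(s', t'). proj_norm scale nrm k (grade k (X s' t' - X s t))) \<longlongrightarrow> 0)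
          (at (s, t) within time_simplex T)) \<and>
     finite_p_variation scale nrm p T n X"

definition rough_path ::
  "('f::real_normed_field \<Rightarrow> 'v::ab_group_add \<Rightarrow> 'v) \<Rightarrow> ('v \<Rightarrow> real) \<Rightarrow> real \<Rightarrow> real \<Rightarrow>
     (real \<Rightarrow> real \<Rightarrow> ('v, 'f) tensor) \<Rightarrow> bool" where
  "rough_path scale nrm p T X \<longleftrightarrow>
     1 \<le> p \<and> 0 \<le> T \<and> multiplicative_functional scale nrm p T (nat \<lfloor>p\<rfloor>) X"

definition weakly_geometric_rough_path ::
  "('f::real_normed_field \<Rightarrow> 'v::ab_group_add \<Rightarrow> 'v) \<Rightarrow> ('v \<Rightarrow> real) \<Rightarrow> real \<Rightarrow> real \<Rightarrow>
     (real \<Rightarrow> real \<Rightarrow> ('v, 'f) tensor) \<Rightarrow> bool" where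
  "weakly_geometric_rough_path scale nrm p T X \<longleftrightarrow>
     rough_path scale nrm p T X \<and> (\<forall>(s, t)\<in>time_simplex T. X s t \<in> grouplike scale (nat \<lfloor>p\<rfloor>))"

definition lyons_extension ::
  "('f::real_normed_field \<Rightarrow> 'v::ab_group_add \<Rightarrow> 'v) \<Rightarrow> ('v \<Rightarrow> real) \<Rightarrow> real \<Rightarrow> real \<Rightarrow>
     (real \<Rightarrow> real \<Rightarrow> ('v, 'f) tensor) \<Rightarrow> (real \<Rightarrow> real \<Rightarrow> ('v, 'f) tensor) \<Rightarrow> bool" where
  "lyons_extension scale nrm p T X Y \<longleftrightarrow>
     (\<forall>n. multiplicative_functional scale nrm p T n (\<lambda>s t. truncate n (Y s t))) \<and>
     (\<forall>(s, t)\<in>time_simplex T. truncate (nat \<lfloor>p\<rfloor>) (Y s t) = X s t)"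

text \<open>
  \<open>g\<close> is the signature of some weakly geometric rough path (the extension \<open>Y\<close> exists and is
  unique on the simplex by Lyons' extension theorem).
\<close>

definition weakly_geometric_signature ::
  "('f::real_normed_field \<Rightarrow> 'v::ab_group_add \<Rightarrow> 'v) \<Rightarrow> ('v \<Rightarrow> real) \<Rightarrow> ('v, 'f) tensor \<Rightarrow> bool" where
  "weakly_geometric_signature scale nrm g \<longleftrightarrow>
     (\<exists>p T X Y. weakly_geometric_rough_path scale nrm p T X \<and>
        lyons_extension scale nrm p T X Y \<and> g = Y 0 T)"

section \<open>Finite dimensional developments\<close>

text \<open>
  Finite dimensional complex normed spaces are taken as subspaces \<open>W\<close> of the space of complex
  sequences with an arbitrary norm \<open>N\<close> on \<open>W\<close>; up to isometry these are all of them. Endomorphisms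
  of \<open>W\<close> are extended by 0 outside \<open>W\<close>, so that equality of functions is equality on \<open>W\<close>.
\<close>

definition fd_normed_space :: "(nat \<Rightarrow> complex) set \<Rightarrow> ((nat \<Rightarrow> complex) \<Rightarrow> real) \<Rightarrow> bool" where
  "fd_normed_space W N \<longleftrightarrow> (\<exists>B. finite B \<and> W = fscale.span B) \<and> norm_on fscale W N"

definition endomorphisms ::
  "(nat \<Rightarrow> complex) set \<Rightarrow> ((nat \<Rightarrow> complex) \<Rightarrow> (nat \<Rightarrow> complex)) set" where
  "endomorphisms W = {A.
     (\<forall>w\<in>W. A w \<in> W) \<and> (\<forall>w. w \<notin> W \<longrightarrow> A w = 0) \<and>
     (\<forall>w\<in>W. \<forall>w'\<in>W. A (w + w') = A w + A w') \<and>
     (\<forall>c. \<forall>w\<in>W. A (fscale c w) = fscale c (A w))}"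

definition id_on :: "(nat \<Rightarrow> complex) set \<Rightarrow> (nat \<Rightarrow> complex) \<Rightarrow> (nat \<Rightarrow> complex)" where
  "id_on W = (\<lambda>w. if w \<in> W then w else 0)"

definition op_norm ::
  "(nat \<Rightarrow> complex) set \<Rightarrow> ((nat \<Rightarrow> complex) \<Rightarrow> real) \<Rightarrow> ((nat \<Rightarrow> complex) \<Rightarrow> (nat \<Rightarrow> complex)) \<Rightarrow> real" where
  "op_norm W N A = Sup {N (A w) | w. w \<in> W \<and> N w \<le> 1}"

definition development ::
  "('f::real_or_complex \<Rightarrow> 'v::ab_group_add \<Rightarrow> 'v) \<Rightarrow> (nat \<Rightarrow> complex) set \<Rightarrow>
     ((nat \<Rightarrow> complex) \<Rightarrow> real) \<Rightarrow> ('v \<Rightarrow> (nat \<Rightarrow> complex) \<Rightarrow> (nat \<Rightarrow> complex)) \<Rightarrow> bool" where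
  "development scale W N \<Phi> \<longleftrightarrow>
     fd_normed_space W N \<and>
     (\<forall>v. \<Phi> v \<in> endomorphisms W) \<and>
     (\<forall>u v. \<Phi> (u + v) = \<Phi> u + \<Phi> v) \<and>
     (\<forall>c v. \<Phi> (scale c v) = (\<lambda>w. fscale (to_complex c) (\<Phi> v w)))"

text \<open>
  The induced map on the tensor power of degree \<open>n \<ge> 1\<close>: its value does not depend on the
  representation of \<open>\<xi>\<close> as a sum of elementary tensors \<open>v\<^sub>1 \<otimes> \<dots> \<otimes> v\<^sub>n\<close>.
\<close>

definition dev_power ::
  "('f::field \<Rightarrow> 'v::ab_group_add \<Rightarrow> 'v) \<Rightarrow> (nat \<Rightarrow> complex) set \<Rightarrow>
     ('v \<Rightarrow> (nat \<Rightarrow> complex) \<Rightarrow> (nat \<Rightarrow> complex)) \<Rightarrow> nat \<Rightarrow> ('v, 'f) tensor \<Rightarrow>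
     (nat \<Rightarrow> complex) \<Rightarrow> (nat \<Rightarrow> complex)" where
  "dev_power scale W \<Phi> n \<xi> =
     (THE A. \<exists>R. (\<forall>vs\<in>set R. length vs = n) \<and> \<xi> = (\<Sum>vs\<leftarrow>R. tensor_of scale vs) \<and>
        A = (\<Sum>vs\<leftarrow>R. foldr (\<lambda>v B. \<Phi> v \<circ> B) vs (id_on W)))"

definition dev_partial_sum ::
  "('f::real_or_complex \<Rightarrow> 'v::ab_group_add \<Rightarrow> 'v) \<Rightarrow> (nat \<Rightarrow> complex) set \<Rightarrow>
     ('v \<Rightarrow> (nat \<Rightarrow> complex) \<Rightarrow> (nat \<Rightarrow> complex)) \<Rightarrow> ('v, 'f) tensor \<Rightarrow> nat \<Rightarrow>
     (nat \<Rightarrow> complex) \<Rightarrow> (nat \<Rightarrow> complex)" where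
  "dev_partial_sum scale W \<Phi> \<xi> M =
     (\<lambda>w. fscale (to_complex (\<xi> [])) (id_on W w)) + (\<Sum>n=1..M. dev_power scale W \<Phi> n (grade n \<xi>))"

text \<open>The series \<open>\<Phi>(\<xi>)\<close> converges to \<open>A\<close> in operator norm.\<close>

definition dev_sums ::
  "('f::real_or_complex \<Rightarrow> 'v::ab_group_add \<Rightarrow> 'v) \<Rightarrow> (nat \<Rightarrow> complex) set \<Rightarrow>
     ((nat \<Rightarrow> complex) \<Rightarrow> real) \<Rightarrow> ('v \<Rightarrow> (nat \<Rightarrow> complex) \<Rightarrow> (nat \<Rightarrow> complex)) \<Rightarrow>
     ('v, 'f) tensor \<Rightarrow> ((nat \<Rightarrow> complex) \<Rightarrow> (nat \<Rightarrow> complex)) \<Rightarrow> bool" where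
  "dev_sums scale W N \<Phi> \<xi> A \<longleftrightarrow>
     A \<in> endomorphisms W \<and>
     (\<lambda>M. op_norm W N (dev_partial_sum scale W \<Phi> \<xi> M - A)) \<longlonglongrightarrow> 0"

end

theory Submission
  imports Defs
begin

text \<open>
  Lie polynomials and signatures are tensor series, and any two distinct tensor series are separated
  by a nilpotent development. A tensor of degree \<open>n\<close> is a form on lists of \<open>n\<close> linear functionals, so
  two distinct tensor series \<open>\<xi>\<close> and \<open>\<eta>\<close> take different values on some list
  \<open>fs = [f\<^sub>0, \<dots>, f\<^sub>n\<^sub>-\<^sub>1]\<close> of linear functionals. On the complex space with basis \<open>e\<^sub>0, \<dots>, e\<^sub>n\<close>, let

  \<open>\<Phi> v e\<^sub>0 = 0\<close>, \<open>\<Phi> v e\<^sub>i\<^sub>+\<^sub>1 = f\<^sub>i(v) e\<^sub>i\<close>.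

  Multiplying these superdiagonal matrices, the matrix entry of \<open>\<Phi>(v\<^sub>1) \<dots> \<Phi>(v\<^sub>k)\<close> in row \<open>i\<close> and column
  \<open>i + k\<close> is \<open>f\<^sub>i(v\<^sub>1) \<dots> f\<^sub>i\<^sub>+\<^sub>k\<^sub>-\<^sub>1(v\<^sub>k)\<close>, and all its other entries vanish. By linearity the entry of
  \<open>\<Phi>(\<xi>)\<close> in row \<open>i\<close> and column \<open>j \<ge> i\<close> is \<open>\<xi> [f\<^sub>i, \<dots>, f\<^sub>j\<^sub>-\<^sub>1]\<close>. In particular the entry in row \<open>0\<close> and
  column \<open>n\<close> is \<open>\<xi> fs\<close>, which differs from \<open>\<eta> fs\<close>. Every product of more than \<open>n\<close> of the matrices \<open>\<Phi> v\<close>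
  is zero, so the series \<open>\<Phi>(\<xi>)\<close> is a finite sum.

  The entries are computed in \<open>dev_power_chain\<close>; the separation of tensor series is in
  \<open>tensor_series_separated\<close>.
\<close>

section \<open>Tensors as sums of elementary tensors\<close>

text \<open>
  This ensures that a list on which two tensor series differ consists of linear functionals, as needed
  for the development built from it.
\<close>

lemma tensor_power_vanishes_nonlinear:
  assumes "\<xi> \<in> tensor_power scale n" "f \<in> set fs" "\<not> Vector_Spaces.linear scale (*) f"
  shows "\<xi> fs = 0"
  using assms(1) unfolding tensor_power_def
proof (induction rule: fscale.span_induct_alt)
  case base
  then show ?case by simp
next
  case (step c x y)
  then obtain vs where "x = tensor_of scale vs" by blast
  then have "x fs = 0" using assms(2,3) by (auto simp: tensor_of_def)
  then show ?case using step by (simp add: fscale_def)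
qed

lemma tensor_of_scale_Cons:
  "tensor_of scale (scale c v # vs) = fscale c (tensor_of scale (v # vs))"
proof
  fix fs
  show "tensor_of scale (scale c v # vs) fs = fscale c (tensor_of scale (v # vs)) fs"
    by (cases fs) (auto simp: tensor_of_def fscale_def Vector_Spaces.linear_iff algebra_simps)
qed

text \<open>
  In positive degree the coefficients of a linear combination of elementary tensors can be moved into
  the first factors. In degree \<open>0\<close> there is no factor to absorb them.
\<close>

lemma tensor_power_sum_list:
  assumes "\<xi> \<in> tensor_power scale n" "1 \<le> n"
  shows "\<exists>R. (\<forall>vs\<in>set R. length vs = n) \<and> \<xi> = (\<Sum>vs\<leftarrow>R. tensor_of scale vs)"
  using assms(1) unfolding tensor_power_def
proof (induction rule: fscale.span_induct_alt)
  case base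
  show ?case by (intro exI[of _ "[]"]) simp
next
  case (step c x y)
  then obtain vs R where vs: "x = tensor_of scale vs" "length vs = n"
    and R: "\<forall>vs\<in>set R. length vs = n" "y = (\<Sum>vs\<leftarrow>R. tensor_of scale vs)"
    by blast
  obtain u us where us: "vs = u # us"
    using vs(2) assms(2) by (cases vs) auto
  have "fscale c x + y = (\<Sum>vs\<leftarrow>(scale c u # us) # R. tensor_of scale vs)"
    using vs(1) us R(2) by (simp add: tensor_of_scale_Cons)
  moreover have "\<forall>vs\<in>set ((scale c u # us) # R). length vs = n"
    using R(1) vs(2) us by simp
  ultimately show ?case by blast
qed

section \<open>Lie polynomials and signatures as tensor series\<close>

lemma tmult_add_right: "tmult \<xi> (\<eta> + \<zeta>) = tmult \<xi> \<eta> + tmult \<xi> \<zeta>"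
  by (simp add: tmult_def fun_eq_iff algebra_simps sum.distrib)

lemma tmult_add_left: "tmult (\<eta> + \<zeta>) \<xi> = tmult \<eta> \<xi> + tmult \<zeta> \<xi>"
  by (simp add: tmult_def fun_eq_iff algebra_simps sum.distrib)

lemma tmult_fscale_right: "tmult \<xi> (fscale c \<eta>) = fscale c (tmult \<xi> \<eta>)"
  by (simp add: tmult_def fscale_def fun_eq_iff sum_distrib_left mult_ac)

lemma tmult_fscale_left: "tmult (fscale c \<eta>) \<xi> = fscale c (tmult \<eta> \<xi>)"
  by (simp add: tmult_def fscale_def fun_eq_iff sum_distrib_left mult_ac)

lemma lie_bracket_vector_in_tensor_power:
  assumes "\<eta> \<in> tensor_power scale n"
  shows "lie_bracket (tensor_of scale [v]) \<eta> \<in> tensor_power scale (Suc n)"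
  using assms unfolding tensor_power_def
proof (induction rule: fscale.span_induct_alt)
  case base
  have "lie_bracket (tensor_of scale [v]) 0 = 0"
    by (simp add: lie_bracket_def tmult_def fun_eq_iff)
  then show ?case by (simp only: fscale.span_zero)
next
  case (step c x y)
  then obtain vs where vs: "x = tensor_of scale vs" "length vs = n" by blast
  let ?S = "{tensor_of scale vs | vs. length vs = Suc n}"
  have "tensor_of scale ([v] @ vs) \<in> ?S" "tensor_of scale (vs @ [v]) \<in> ?S"
    using vs(2) by fastforce+
  then have "lie_bracket (tensor_of scale [v]) x \<in> fscale.span ?S"
    unfolding vs(1) lie_bracket_def tmult_tensor_of
    by (intro fscale.span_diff fscale.span_base)
  moreover have "lie_bracket (tensor_of scale [v]) (fscale c x + y) =
      fscale c (lie_bracket (tensor_of scale [v]) x) + lie_bracket (tensor_of scale [v]) y"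
    by (simp add: lie_bracket_def tmult_add_left tmult_add_right tmult_fscale_left
        tmult_fscale_right fscale.scale_right_diff_distrib)
  ultimately show ?case
    using step.IH by (simp only: fscale.span_add fscale.span_scale)
qed

lemma lie_layer_subset_tensor_power: "lie_layer scale n \<subseteq> tensor_power scale n"
proof (induction scale n rule: lie_layer.induct)
  case (1 scale)
  show ?case by (simp add: tensor_power_def fscale.span_zero)
next
  case (2 scale)
  show ?case by (fastforce simp: tensor_power_def intro: fscale.span_base)
next
  case (3 scale n)
  have "{lie_bracket (tensor_of scale [v]) \<eta> | v \<eta>. \<eta> \<in> lie_layer scale (Suc n)}
      \<subseteq> tensor_power scale (Suc (Suc n))"
    using 3 lie_bracket_vector_in_tensor_power by blast
  moreover have "fscale.subspace (tensor_power scale (Suc (Suc n)))"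
    by (simp add: tensor_power_def)
  ultimately show ?case
    by (simp add: fscale.span_minimal)
qed

lemma lie_polynomials_subset_tensor_series: "lie_polynomials scale \<subseteq> tensor_series scale"
  using lie_layer_subset_tensor_power by (force simp: lie_polynomials_def tensor_series_def)

lemma weakly_geometric_signature_in_tensor_series:
  assumes "weakly_geometric_signature scale nrm g"
  shows "g \<in> tensor_series scale"
proof -
  obtain p T X Y where X: "weakly_geometric_rough_path scale nrm p T X"
    and Y: "lyons_extension scale nrm p T X Y" and g: "g = Y 0 T"
    using assms unfolding weakly_geometric_signature_def by blast
  have "(0, T) \<in> time_simplex T"
    using X by (simp add: weakly_geometric_rough_path_def rough_path_def time_simplex_def)
  then have "truncate n g \<in> tensor_series scale" for n
    using Y unfolding g lyons_extension_def multiplicative_functional_def truncated_tensors_def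
    by blast
  then have "grade n (truncate n g) \<in> tensor_power scale n" for n
    by (simp add: tensor_series_def)
  moreover have "grade n (truncate n g) = grade n g" for n
    by (simp add: grade_def truncate_def fun_eq_iff)
  ultimately show ?thesis by (simp add: tensor_series_def)
qed

section \<open>The nilpotent development along a list of functionals\<close>

definition chain_space :: "nat \<Rightarrow> (nat \<Rightarrow> complex) set" where
  "chain_space n = {w. \<forall>i>n. w i = 0}"

definition chain_norm :: "nat \<Rightarrow> (nat \<Rightarrow> complex) \<Rightarrow> real" where
  "chain_norm n w = (\<Sum>i\<le>n. norm (w i))"

definition chain_development ::
  "('v \<Rightarrow> 'f::real_or_complex) list \<Rightarrow> 'v \<Rightarrow> (nat \<Rightarrow> complex) \<Rightarrow> (nat \<Rightarrow> complex)" where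
  "chain_development fs v w = (\<lambda>i.
     if w \<in> chain_space (length fs) \<and> i < length fs
     then to_complex ((fs ! i) v) * w (Suc i) else 0)"

text \<open>
  The matrix with the entry \<open>\<xi> [f\<^sub>i, \<dots>, f\<^sub>i\<^sub>+\<^sub>k\<^sub>-\<^sub>1]\<close> in row \<open>i\<close> and column \<open>i + k\<close>. Near the end of \<open>fs\<close> the
  list in this formula is shorter than \<open>k\<close>, but then, for \<open>w\<close> in the space, \<open>w (i + k) = 0\<close>.
\<close>

definition chain_diagonal ::
  "('v \<Rightarrow> 'f::real_or_complex) list \<Rightarrow> nat \<Rightarrow> ('v, 'f) tensor \<Rightarrow> (nat \<Rightarrow> complex) \<Rightarrow> (nat \<Rightarrow> complex)"
  where
  "chain_diagonal fs k \<xi> w = (\<lambda>i.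
     if w \<in> chain_space (length fs) then to_complex (\<xi> (take k (drop i fs))) * w (i + k) else 0)"

lemma to_complex_zero: "to_complex 0 = 0"
  using to_complex_add[of 0 0] by simp

lemma inj_to_complex: "inj to_complex"
proof (rule injI)
  fix x y :: "'a::real_or_complex"
  assume "to_complex x = to_complex y"
  then have "to_complex (x - y) = 0"
    using to_complex_add[of "x - y" y] by simp
  then show "x = y" using norm_to_complex[of "x - y"] by simp
qed

lemma fd_normed_space_chain: "fd_normed_space (chain_space n) (chain_norm n)"
proof -
  define e :: "nat \<Rightarrow> nat \<Rightarrow> complex" where "e = (\<lambda>i j. if j = i then 1 else 0)"
  have "w \<in> fscale.span (e ` {..n})" if "w \<in> chain_space n" for w
  proof -
    have eval: "(\<Sum>i\<in>I. x i) j = (\<Sum>i\<in>I. x i j)" if "finite I"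
      for I :: "nat set" and x :: "nat \<Rightarrow> nat \<Rightarrow> complex" and j
      using that by induction auto
    have "w = (\<Sum>i\<le>n. fscale (w i) (e i))"
    proof
      fix j
      have "(\<Sum>i\<le>n. fscale (w i) (e i)) j = (\<Sum>i\<le>n. if i = j then w i else 0)"
        unfolding eval[OF finite_atMost] by (intro sum.cong) (auto simp: fscale_def e_def)
      also have "\<dots> = w j" using that by (auto simp: chain_space_def)
      finally show "w j = (\<Sum>i\<le>n. fscale (w i) (e i)) j" by simp
    qed
    also have "\<dots> \<in> fscale.span (e ` {..n})"
      by (intro fscale.span_sum fscale.span_scale fscale.span_base) auto
    finally show ?thesis .
  qed
  moreover have "fscale.span (e ` {..n}) \<subseteq> chain_space n"
    by (intro fscale.span_minimal fscale.subspaceI)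
      (auto simp: chain_space_def e_def fscale_def)
  ultimately have "chain_space n = fscale.span (e ` {..n})" by blast
  moreover have "norm_on fscale (chain_space n) (chain_norm n)"
    unfolding norm_on_def
  proof (intro conjI ballI allI)
    fix x assume x: "x \<in> chain_space n"
    show "0 \<le> chain_norm n x" by (simp add: chain_norm_def sum_nonneg)
    show "chain_norm n x = 0 \<longleftrightarrow> x = 0"
      using x by (fastforce simp: chain_norm_def chain_space_def fun_eq_iff sum_nonneg_eq_0_iff
          not_le[symmetric])
    show "chain_norm n (x + y) \<le> chain_norm n x + chain_norm n y" for y
      by (auto simp: chain_norm_def sum.distrib[symmetric] intro!: sum_mono norm_triangle_ineq)
    show "chain_norm n (fscale c x) = norm c * chain_norm n x" for c
      by (simp add: chain_norm_def fscale_def norm_mult sum_distrib_left)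
  qed
  ultimately show ?thesis unfolding fd_normed_space_def by blast
qed

lemma development_chain:
  assumes "\<And>f. f \<in> set fs \<Longrightarrow> Vector_Spaces.linear scale (*) f"
  shows "development scale (chain_space (length fs)) (chain_norm (length fs)) (chain_development fs)"
proof -
  have lin: "(fs ! i) (u + v) = (fs ! i) u + (fs ! i) v" "(fs ! i) (scale c v) = c * (fs ! i) v"
    if "i < length fs" for i u v c
    using assms[of "fs ! i"] that by (auto simp: Vector_Spaces.linear_iff)
  show ?thesis
    unfolding development_def endomorphisms_def
    by (intro conjI fd_normed_space_chain)
      (auto simp: chain_development_def chain_space_def fun_eq_iff lin fscale_def to_complex_add
        to_complex_mult algebra_simps)
qed

text \<open>
  Each factor moves the nonzero superdiagonal one step further from the diagonal. In row \<open>i\<close> the new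
  factor multiplies the old row \<open>i + 1\<close> by \<open>f\<^sub>i(v)\<close>, which prepends \<open>f\<^sub>i\<close> to the list of functionals
  of that row.
\<close>

lemma foldr_chain_development:
  assumes "\<And>f. f \<in> set fs \<Longrightarrow> Vector_Spaces.linear scale (*) f"
  shows "foldr (\<lambda>v B. chain_development fs v \<circ> B) vs (id_on (chain_space (length fs))) =
    chain_diagonal fs (length vs) (tensor_of scale vs)"
proof (induction vs)
  case Nil
  show ?case
    by (auto simp: fun_eq_iff id_on_def chain_diagonal_def tensor_of_def to_complex_one)
next
  case (Cons v vs)
  let ?n = "length fs" and ?k = "length vs"
  have "chain_development fs v (chain_diagonal fs ?k (tensor_of scale vs) w) i =
    chain_diagonal fs (Suc ?k) (tensor_of scale (v # vs)) w i" for w i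
  proof (cases "w \<in> chain_space ?n")
    case w: True
    then have D: "chain_diagonal fs ?k (tensor_of scale vs) w \<in> chain_space ?n"
      by (auto simp: chain_diagonal_def chain_space_def)
    show ?thesis
    proof (cases "i < ?n")
      case True
      then have "take (Suc ?k) (drop i fs) = fs ! i # take ?k (drop (Suc i) fs)"
        by (simp add: Cons_nth_drop_Suc[symmetric])
      moreover have "Vector_Spaces.linear scale (*) (fs ! i)"
        using assms True by simp
      ultimately have "tensor_of scale (v # vs) (take (Suc ?k) (drop i fs)) =
          (fs ! i) v * tensor_of scale vs (take ?k (drop (Suc i) fs))"
        by (simp add: tensor_of_def)
      then show ?thesis
        using D w True by (simp add: chain_development_def chain_diagonal_def to_complex_mult)
    next
      case False
      then have "w (i + Suc ?k) = 0" using w by (simp add: chain_space_def)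
      then show ?thesis using False by (simp add: chain_development_def chain_diagonal_def)
    qed
  next
    case False
    then show ?thesis by (simp add: chain_development_def chain_diagonal_def)
  qed
  then have step: "chain_development fs v \<circ> chain_diagonal fs ?k (tensor_of scale vs) =
      chain_diagonal fs (Suc ?k) (tensor_of scale (v # vs))"
    by (simp only: fun_eq_iff o_apply) blast
  have "foldr (\<lambda>v B. chain_development fs v \<circ> B) (v # vs) (id_on (chain_space ?n)) =
      chain_development fs v \<circ>
        foldr (\<lambda>v B. chain_development fs v \<circ> B) vs (id_on (chain_space ?n))"
    by simp
  also have "\<dots> = chain_development fs v \<circ> chain_diagonal fs ?k (tensor_of scale vs)"
    by (rule arg_cong[OF Cons.IH])
  finally show ?case unfolding step length_Cons .
qed

lemma chain_diagonal_sum_list: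
  "chain_diagonal fs k (\<Sum>x\<leftarrow>xs. t x) = (\<Sum>x\<leftarrow>xs. chain_diagonal fs k (t x))"
proof (induction xs)
  case Nil
  show ?case by (simp add: fun_eq_iff chain_diagonal_def to_complex_zero)
next
  case (Cons x xs)
  have "chain_diagonal fs k (\<xi> + \<eta>) = chain_diagonal fs k \<xi> + chain_diagonal fs k \<eta>" for \<xi> \<eta>
    by (simp add: fun_eq_iff chain_diagonal_def to_complex_add algebra_simps)
  then show ?case by (simp only: list.map sum_list.Cons Cons.IH)
qed

text \<open>
  Every representation of \<open>\<xi>\<close> as a sum of elementary tensors yields the same endomorphism, because the
  entries are values of the form \<open>\<xi>\<close> itself. So the definite description has a unique solution.
\<close>

lemma dev_power_chain:
  assumes "\<And>f. f \<in> set fs \<Longrightarrow> Vector_Spaces.linear scale (*) f"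
    and "\<xi> \<in> tensor_power scale k" "1 \<le> k"
  shows "dev_power scale (chain_space (length fs)) (chain_development fs) k \<xi> =
    chain_diagonal fs k \<xi>"
proof -
  let ?F = "\<lambda>vs. foldr (\<lambda>v B. chain_development fs v \<circ> B) vs (id_on (chain_space (length fs)))"
  have eq: "(\<Sum>vs\<leftarrow>R. ?F vs) = chain_diagonal fs k \<xi>"
    if "\<forall>vs\<in>set R. length vs = k" "\<xi> = (\<Sum>vs\<leftarrow>R. tensor_of scale vs)" for R
  proof -
    have "(\<Sum>vs\<leftarrow>R. ?F vs) = (\<Sum>vs\<leftarrow>R. chain_diagonal fs k (tensor_of scale vs))"
    proof (intro arg_cong[where f = sum_list] map_cong refl)
      fix vs assume "vs \<in> set R"
      then have "length vs = k" using that(1) by blast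
      then show "?F vs = chain_diagonal fs k (tensor_of scale vs)"
        using foldr_chain_development[OF assms(1), of fs vs] by blast
    qed
    then show ?thesis unfolding that(2) chain_diagonal_sum_list .
  qed
  obtain R where R: "\<forall>vs\<in>set R. length vs = k" "\<xi> = (\<Sum>vs\<leftarrow>R. tensor_of scale vs)"
    using tensor_power_sum_list[OF assms(2,3)] by blast
  show ?thesis
    unfolding dev_power_def
  proof (rule the_equality)
    show "\<exists>R. (\<forall>vs\<in>set R. length vs = k) \<and> \<xi> = (\<Sum>vs\<leftarrow>R. tensor_of scale vs) \<and>
        chain_diagonal fs k \<xi> = (\<Sum>vs\<leftarrow>R. ?F vs)"
      using R eq[OF R, symmetric] by (intro exI[of _ R] conjI)
  next
    fix A
    assume "\<exists>R. (\<forall>vs\<in>set R. length vs = k) \<and> \<xi> = (\<Sum>vs\<leftarrow>R. tensor_of scale vs) \<and>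
        A = (\<Sum>vs\<leftarrow>R. ?F vs)"
    then show "A = chain_diagonal fs k \<xi>"
      by (elim exE conjE) (simp only: eq)
  qed
qed

definition chain_operator ::
  "('v \<Rightarrow> 'f::real_or_complex) list \<Rightarrow> ('v, 'f) tensor \<Rightarrow> (nat \<Rightarrow> complex) \<Rightarrow> (nat \<Rightarrow> complex)" where
  "chain_operator fs \<xi> = (\<Sum>k\<le>length fs. chain_diagonal fs k \<xi>)"

text \<open>
  The superdiagonals beyond the length of \<open>fs\<close> lie outside the matrix, so the partial sums are
  eventually constant.
\<close>

lemma dev_sums_chain:
  assumes lin: "\<And>f. f \<in> set fs \<Longrightarrow> Vector_Spaces.linear scale (*) f"
    and \<xi>: "\<xi> \<in> tensor_series scale"
  shows "dev_sums scale (chain_space (length fs)) (chain_norm (length fs)) (chain_development fs)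
    \<xi> (chain_operator fs \<xi>)"
proof -
  let ?n = "length fs"
  let ?W = "chain_space ?n"
  have grade: "chain_diagonal fs k (grade k \<xi>) = chain_diagonal fs k \<xi>" for k
    by (auto simp: fun_eq_iff chain_diagonal_def grade_def chain_space_def)
  have zeroth: "(\<lambda>w. fscale (to_complex (\<xi> [])) (id_on ?W w)) = chain_diagonal fs 0 \<xi>"
    by (auto simp: fun_eq_iff chain_diagonal_def fscale_def id_on_def)
  have partial: "dev_partial_sum scale ?W (chain_development fs) \<xi> M =
      (\<Sum>k\<le>M. chain_diagonal fs k \<xi>)" for M
  proof -
    have "dev_power scale ?W (chain_development fs) k (grade k \<xi>) = chain_diagonal fs k \<xi>"
      if "k \<in> {1..M}" for k
      using dev_power_chain[OF lin, of fs "grade k \<xi>" k] \<xi> that grade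
      by (auto simp: tensor_series_def)
    then have "dev_partial_sum scale ?W (chain_development fs) \<xi> M =
        chain_diagonal fs 0 \<xi> + (\<Sum>k=1..M. chain_diagonal fs k \<xi>)"
      unfolding dev_partial_sum_def zeroth by (metis (no_types, lifting) sum.cong)
    also have "\<dots> = (\<Sum>k\<le>M. chain_diagonal fs k \<xi>)"
      by (simp add: atMost_atLeast0 sum.atLeast_Suc_atMost)
    finally show ?thesis .
  qed
  have const: "(\<Sum>k\<le>M. chain_diagonal fs k \<xi>) = chain_operator fs \<xi>" if "?n \<le> M" for M
  proof -
    have "chain_diagonal fs k \<xi> = 0" if "k > ?n" for k
      using that by (auto simp: fun_eq_iff chain_diagonal_def chain_space_def)
    then show ?thesis
      unfolding chain_operator_def using that by (intro sum.mono_neutral_right) auto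
  qed
  have "op_norm ?W (chain_norm ?n) 0 = 0"
  proof -
    have "{chain_norm ?n ((0 :: (nat \<Rightarrow> complex) \<Rightarrow> nat \<Rightarrow> complex) w) | w.
        w \<in> ?W \<and> chain_norm ?n w \<le> 1} = {0}"
      by (auto simp: chain_norm_def chain_space_def intro!: exI[of _ 0])
    then show ?thesis by (simp add: op_norm_def)
  qed
  then have "\<forall>\<^sub>F M in sequentially. op_norm ?W (chain_norm ?n)
      (dev_partial_sum scale ?W (chain_development fs) \<xi> M - chain_operator fs \<xi>) = 0"
    by (intro eventually_sequentiallyI[of ?n]) (simp only: partial const diff_self)
  moreover have "chain_operator fs \<xi> \<in> endomorphisms ?W"
  proof -
    have diagonal: "chain_diagonal fs k \<xi> \<in> endomorphisms ?W" for k
      by (auto simp: endomorphisms_def chain_diagonal_def chain_space_def fun_eq_iff fscale_def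
          algebra_simps)
    have add: "A + B \<in> endomorphisms ?W" if "A \<in> endomorphisms ?W" "B \<in> endomorphisms ?W"
      for A B
      using that by (auto simp: endomorphisms_def chain_space_def fun_eq_iff fscale_def
          algebra_simps)
    have zero: "0 \<in> endomorphisms ?W"
      by (auto simp: endomorphisms_def chain_space_def fun_eq_iff fscale_def)
    have "(\<Sum>k\<in>I. chain_diagonal fs k \<xi>) \<in> endomorphisms ?W" if "finite I" for I
      using that
    proof (induction I)
      case empty
      show ?case unfolding sum.empty by (rule zero)
    next
      case (insert k I)
      then show ?case unfolding sum.insert[OF insert.hyps] by (intro add diagonal)
    qed
    from this[OF finite_atMost] show ?thesis unfolding chain_operator_def .
  qed
  ultimately show ?thesis
    unfolding dev_sums_def by (simp add: tendsto_eventually)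
qed

section \<open>Separation of tensor series\<close>

lemma tensor_series_separated:
  fixes scale :: "'f::real_or_complex \<Rightarrow> 'v::ab_group_add \<Rightarrow> 'v"
  assumes \<xi>: "\<xi> \<in> tensor_series scale" and \<eta>: "\<eta> \<in> tensor_series scale" and "\<xi> \<noteq> \<eta>"
  shows "\<exists>W N \<Phi> A B. development scale W N \<Phi> \<and>
    dev_sums scale W N \<Phi> \<xi> A \<and> dev_sums scale W N \<Phi> \<eta> B \<and> A \<noteq> B"
proof -
  obtain fs where fs: "\<xi> fs \<noteq> \<eta> fs" using assms(3) by (auto simp: fun_eq_iff)
  let ?n = "length fs"
  have lin: "Vector_Spaces.linear scale (*) f" if f: "f \<in> set fs" for f
  proof (rule ccontr)
    assume nonlinear: "\<not> ?thesis"
    have "\<zeta> fs = 0" if "\<zeta> \<in> tensor_series scale" for \<zeta>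
    proof -
      have "grade ?n \<zeta> \<in> tensor_power scale ?n" using that by (simp add: tensor_series_def)
      from tensor_power_vanishes_nonlinear[OF this f nonlinear] show ?thesis
        by (simp add: grade_def)
    qed
    from this[OF \<xi>] this[OF \<eta>] show False using fs by simp
  qed
  \<comment> \<open>The last basis vector: it reads off the entry in the top right corner.\<close>
  define e :: "nat \<Rightarrow> complex" where "e = (\<lambda>j. if j = ?n then 1 else 0)"
  have "chain_operator fs \<zeta> e 0 = to_complex (\<zeta> fs)" for \<zeta>
  proof -
    have eval: "(\<Sum>k\<in>I. x k) e 0 = (\<Sum>k\<in>I. x k e 0)" if "finite I"
      for I :: "nat set" and x :: "nat \<Rightarrow> (nat \<Rightarrow> complex) \<Rightarrow> nat \<Rightarrow> complex"
      using that by induction auto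
    have "chain_operator fs \<zeta> e 0 = (\<Sum>k\<le>?n. if k = ?n then to_complex (\<zeta> fs) else 0)"
      unfolding chain_operator_def eval[OF finite_atMost]
      by (intro sum.cong) (auto simp: chain_diagonal_def e_def chain_space_def)
    then show ?thesis by simp
  qed
  then have "chain_operator fs \<xi> e 0 \<noteq> chain_operator fs \<eta> e 0"
    using fs by (simp only: inj_eq[OF inj_to_complex] not_False_eq_True)
  then have "chain_operator fs \<xi> \<noteq> chain_operator fs \<eta>" by force
  with development_chain[of fs, OF lin] dev_sums_chain[of fs, OF lin \<xi>]
    dev_sums_chain[of fs, OF lin \<eta>]
  show ?thesis by (intro exI conjI)
qed

theorem corollary4p1:
  fixes scale :: "'f::real_or_complex \<Rightarrow> 'v::ab_group_add \<Rightarrow> 'v"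
    and Basis :: "'v set"
    and nrm :: "'v \<Rightarrow> real"
  assumes "finite_dimensional_vector_space scale Basis"
    and "norm_on scale UNIV nrm"
  shows "(\<forall>l\<in>lie_polynomials scale. \<forall>l'\<in>lie_polynomials scale. l \<noteq> l' \<longrightarrow>
            (\<exists>W N \<Phi> A A'. development scale W N \<Phi> \<and>
               dev_sums scale W N \<Phi> l A \<and> dev_sums scale W N \<Phi> l' A' \<and> A \<noteq> A')) \<and>
         (\<forall>g\<^sub>1 g\<^sub>2. weakly_geometric_signature scale nrm g\<^sub>1 \<longrightarrow>
            weakly_geometric_signature scale nrm g\<^sub>2 \<longrightarrow> g\<^sub>1 \<noteq> g\<^sub>2 \<longrightarrow>
            (\<exists>W N \<Phi> A\<^sub>1 A\<^sub>2. development scale W N \<Phi> \<and>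
               dev_sums scale W N \<Phi> g\<^sub>1 A\<^sub>1 \<and> dev_sums scale W N \<Phi> g\<^sub>2 A\<^sub>2 \<and> A\<^sub>1 \<noteq> A\<^sub>2))"
proof (intro conjI ballI allI impI)
  fix l l' assume l: "l \<in> lie_polynomials scale" "l' \<in> lie_polynomials scale" and ne: "l \<noteq> l'"
  show "\<exists>W N \<Phi> A A'. development scale W N \<Phi> \<and>
      dev_sums scale W N \<Phi> l A \<and> dev_sums scale W N \<Phi> l' A' \<and> A \<noteq> A'"
    by (rule tensor_series_separated[OF l[THEN subsetD[OF lie_polynomials_subset_tensor_series]] ne])
next
  fix g\<^sub>1 g\<^sub>2
  assume g: "weakly_geometric_signature scale nrm g\<^sub>1" "weakly_geometric_signature scale nrm g\<^sub>2"
    and ne: "g\<^sub>1 \<noteq> g\<^sub>2"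
  show "\<exists>W N \<Phi> A\<^sub>1 A\<^sub>2. development scale W N \<Phi> \<and>
      dev_sums scale W N \<Phi> g\<^sub>1 A\<^sub>1 \<and> dev_sums scale W N \<Phi> g\<^sub>2 A\<^sub>2 \<and> A\<^sub>1 \<noteq> A\<^sub>2"
    by (rule tensor_series_separated[OF g[THEN weakly_geometric_signature_in_tensor_series] ne])
qed

end
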